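(* Let $f\in C^4([0,h])$ be a real-valued function interpolated on $[0,h]$, where $h>0$ and $h\to0$, and let $P\in\mathbb{R}$. Consider the parametric area-preserving cubic Bézier curves $\vec{B}_h=\langle B_{h_1},B_{h_2}\rangle$ interpolating $f$ on $[0,h]$ (see context) which satisfy $$B_{h_1}'(0)=r_1=h+Ph^3,\qquad B_{h_1}'(1)=r_2=\frac{6\left(10\,\mathcal{C}_R-r_1(\vec{D}\times\vec{\alpha})\right)}{r_1(\vec{\alpha}\times\vec{\beta})+6(\vec{\beta}\times\vec{D})}.$$ These curves are $5^{th}$ order accurate, i.e. $$\|B_{h_2}(t)-f(B_{h_1}(t))\|_{L^\infty(t\in[0,1])}=\mathcal{O}(h^5)\quad\text{as }h\to0,$$ provided the curvature of the graph of $f$ does not vanish at the endpoints. In the zero curvature case, the interpolation is $4^{th}$ order accurate, i.e. $$\|B_{h_2}(t)-f(B_{h_1}(t))\|_{L^\infty(t\in[0,1])}=\mathcal{O}(h^4)\quad\text{as }h\to0.$$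
   Context: For planar vectors, $\vec{u}\times\vec{v}=u_1v_2-v_1u_2$. The target curve is the graph of $f$ over $[0,h]$; its curvature vanishes at a point $x$ exactly when $f''(x)=0$, and the zero curvature case is the one in which the curvature vanishes at an endpoint. After shifting the left endpoint to the origin, the data on $[0,h]$ are $\vec{\alpha}=\langle 1,f'(0)\rangle$, $\vec{\beta}=\langle 1,f'(h)\rangle$, $\vec{D}=\langle h,\,f(h)-f(0)\rangle$, and the signed area of $f$ about its secant line is $$\mathcal{C}_R=\int_0^h f(x)\,dx-\frac{h\,(f(0)+f(h))}{2}.$$ For positive parameters $r_1,r_2$ (which may depend on $h$) the cubic Bézier interpolant of $f$ on $[0,h]$ is $$\vec{B}_h(t)=\langle 0,f(0)\rangle+r_1\vec{\alpha}(1-t)^2t+3\Big(\vec{D}-\frac{r_2\vec{\beta}}{3}\Big)(1-t)t^2+\vec{D}t^3,\qquad t\in[0,1].$$ It matches the values and tangent directions of the graph of $f$ at $x=0$ and $x=h$, with $\vec{B}_h'(0)=r_1\vec{\alpha}$ and $\vec{B}_h'(1)=r_2\vec{\beta}$. It is area-preserving, meaning $\int_0^1B_{h_2}(t)B_{h_1}'(t)\,dt=\int_0^hf(x)\,dx$, exactly when $$\frac{r_1r_2}{60}(\vec{\alpha}\times\vec{\beta})+\frac{r_1}{10}(\vec{D}\times\vec{\alpha})+\frac{r_2}{10}(\vec{\beta}\times\vec{D})=\mathcal{C}_R ;$$ the displayed formula for $r_2$ is this equation solved for $r_2$.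
   Formalization: The 5th-order claim fails for general C^4 f (e.g. x^2/2+x^(9/2) gives order 9/2), so f''''(x)-f''''(0)=O(x) as x→0+ is added there; f is fixed and C^4 on some [0,b]; the zero-curvature bound is for h where r1,r2>0, area is preserved and B_h1(t) stays in [0,b]. *)

theory Defs
  imports "HOL-Analysis.Analysis" "HOL-Library.Landau_Symbols"
    "HOL-Probability.Essential_Supremum"
begin

text \<open>Derivatives are taken within \<open>S\<close>, so they are one-sided at the endpoints of an interval and
  do not see the values of the function outside \<open>S\<close>.\<close>

definition nth_deriv_on :: "real set \<Rightarrow> nat \<Rightarrow> (real \<Rightarrow> real) \<Rightarrow> real \<Rightarrow> real" where
  "nth_deriv_on S n f = ((\<lambda>g x. vector_derivative g (at x within S)) ^^ n) f"

definition C_k_on :: "nat \<Rightarrow> real set \<Rightarrow> (real \<Rightarrow> real) \<Rightarrow> bool" where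
  "C_k_on k S f \<longleftrightarrow>
     (\<forall>i<k. nth_deriv_on S i f differentiable_on S) \<and> continuous_on S (nth_deriv_on S k f)"

definition graph_curvature :: "real set \<Rightarrow> (real \<Rightarrow> real) \<Rightarrow> real \<Rightarrow> real" where
  "graph_curvature S f x = nth_deriv_on S 2 f x / (1 + (nth_deriv_on S 1 f x)\<^sup>2) powr (3/2)"

definition cross2 :: "real \<times> real \<Rightarrow> real \<times> real \<Rightarrow> real" where
  "cross2 u v = fst u * snd v - fst v * snd u"

text \<open>Below, \<open>S\<close> is the interval on which the target \<open>f\<close> is defined, and the graph of \<open>f\<close> is
  interpolated over \<open>{0..h} \<subseteq> S\<close>. The vectors \<open>\<alpha>\<close> and \<open>\<beta>\<close> are \<open>tangent S f 0\<close> and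
  \<open>tangent S f h\<close>; the vector \<open>D\<close> is \<open>chord f h\<close>.\<close>

definition tangent :: "real set \<Rightarrow> (real \<Rightarrow> real) \<Rightarrow> real \<Rightarrow> real \<times> real" where
  "tangent S f x = (1, nth_deriv_on S 1 f x)"

definition chord :: "(real \<Rightarrow> real) \<Rightarrow> real \<Rightarrow> real \<times> real" where
  "chord f h = (h, f h - f 0)"

definition secant_area :: "(real \<Rightarrow> real) \<Rightarrow> real \<Rightarrow> real" where
  "secant_area f h = integral {0..h} f - h * (f 0 + f h) / 2"

definition bezier ::
    "real set \<Rightarrow> (real \<Rightarrow> real) \<Rightarrow> real \<Rightarrow> real \<Rightarrow> real \<Rightarrow> real \<Rightarrow> real \<times> real" where
  "bezier S f h r1 r2 t =
     (0, f 0)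
     + (r1 * (1 - t)\<^sup>2 * t) *\<^sub>R tangent S f 0
     + (3 * (1 - t) * t\<^sup>2) *\<^sub>R (chord f h - (r2 / 3) *\<^sub>R tangent S f h)
     + t ^ 3 *\<^sub>R chord f h"

definition area_preserving :: "(real \<Rightarrow> real) \<Rightarrow> real \<Rightarrow> (real \<Rightarrow> real \<times> real) \<Rightarrow> bool" where
  "area_preserving f h B \<longleftrightarrow>
     integral {0..1} (\<lambda>t. snd (B t) * deriv (\<lambda>s. fst (B s)) t) = integral {0..h} f"

text \<open>The last conjunct says that \<open>f\<close> is defined along the abscissae of the curve, so that
  \<open>f (fst (B t))\<close> is meaningful for all \<open>t \<in> {0..1}\<close>.\<close>

definition area_preserving_interpolant ::
    "real set \<Rightarrow> (real \<Rightarrow> real) \<Rightarrow> real \<Rightarrow> real \<Rightarrow> real \<Rightarrow> bool" where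
  "area_preserving_interpolant S f h r1 r2 \<longleftrightarrow>
     0 < r1 \<and> 0 < r2
     \<and> area_preserving f h (bezier S f h r1 r2)
     \<and> (\<forall>t\<in>{0..1}. fst (bezier S f h r1 r2 t) \<in> S)"

definition r1_of :: "real \<Rightarrow> real \<Rightarrow> real" where
  "r1_of P h = h + P * h ^ 3"

text \<open>If the denominator vanishes, the formula is meaningless; its value here is then \<open>0\<close>, which
  \<open>area_preserving_interpolant\<close> excludes.\<close>

definition r2_of :: "real set \<Rightarrow> (real \<Rightarrow> real) \<Rightarrow> real \<Rightarrow> real \<Rightarrow> real" where
  "r2_of S f P h =
     6 * (10 * secant_area f h - r1_of P h * cross2 (chord f h) (tangent S f 0))
     / (r1_of P h * cross2 (tangent S f 0) (tangent S f h)
        + 6 * cross2 (tangent S f h) (chord f h))"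

text \<open>The norm takes the value \<open>\<infinity>\<close> on functions that are essentially unbounded or not measurable.\<close>

definition Linf_norm :: "(real \<Rightarrow> real) \<Rightarrow> ereal" where
  "Linf_norm g = esssup (lebesgue_on {0..1}) (\<lambda>t. ereal \<bar>g t\<bar>)"

definition interp_error :: "(real \<Rightarrow> real) \<Rightarrow> (real \<Rightarrow> real \<times> real) \<Rightarrow> ereal" where
  "interp_error f B = Linf_norm (\<lambda>t. snd (B t) - f (fst (B t)))"

end

theory Submission
  imports Defs
begin

text \<open>Subtracting the line \<open>f 0 + f' 0 x\<close> shears target and curve simultaneously, so only the
  Taylor coefficients \<open>a\<close>, \<open>c\<close>, \<open>d\<close> of \<open>a/2 x\<^sup>2 + c/6 x\<^sup>3 + d/24 x\<^sup>4\<close> and the remainders matter.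
  If \<open>a \<noteq> 0\<close>, the area condition gives \<open>r2 = h (1 - (P + d / (24 a)) h\<^sup>2 + O(h\<^sup>3))\<close>, and with
  this value all terms of order at most 4 in the error cancel, uniformly in \<open>t\<close>. If \<open>a = 0\<close>, the
  cubic terms cancel as soon as \<open>c (r2 / h - 1) = O(h)\<close>, which the area condition provides for
  \<open>c \<noteq> 0\<close>; for \<open>c = 0\<close> it suffices that \<open>r2 = O(h)\<close>, and this follows from the requirement that
  the abscissae of the curve be nonnegative.\<close>

subsection \<open>Taylor expansions\<close>

lemma has_real_derivative_nth_deriv_on:
  assumes "C_k_on k S f" "i < k" "x \<in> S"
  shows "(nth_deriv_on S i f has_real_derivative nth_deriv_on S (Suc i) f x) (at x within S)"
proof -
  have "nth_deriv_on S i f differentiable (at x within S)"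
    using assms by (auto simp: C_k_on_def differentiable_on_def)
  then show ?thesis
    by (simp add: vector_derivative_works has_real_derivative_iff_has_vector_derivative nth_deriv_on_def)
qed

lemma continuous_on_if_C_k_on:
  assumes "C_k_on k S f" "i < k"
  shows "continuous_on S (nth_deriv_on S i f)"
  using assms has_real_derivative_nth_deriv_on DERIV_continuous
  unfolding continuous_on_eq_continuous_within by blast

text \<open>The mean value inequality on \<open>{0..x}\<close> applies, since
  \<open>K * y ^ n\<close> is largest at the right end. The factor 1/(n+1) that integration would
  give is dropped, so the same \<open>K\<close> survives iteration. Derivatives live on
  \<open>{0..b}\<close>, while the bound may hold only on a shorter interval \<open>{0..e}\<close>
  near 0.\<close>

lemma abs_le_power_if_deriv_le_power:
  fixes g :: "real \<Rightarrow> real"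
  assumes deriv: "\<And>y. y \<in> {0..b} \<Longrightarrow> (g has_real_derivative g' y) (at y within {0..b})"
    and "g 0 = 0" and "e \<le> b"
    and bound: "\<And>y. y \<in> {0..e} \<Longrightarrow> \<bar>g' y\<bar> \<le> K * y ^ n"
    and "K \<ge> 0" and x: "x \<in> {0..e}"
  shows "\<bar>g x\<bar> \<le> K * x ^ Suc n"
proof (cases "x = 0")
  case False
  have "norm (g x - g 0) \<le> (K * x ^ n) * norm (x - 0)"
  proof (rule field_differentiable_bound[of "{0..x}" g g'])
    fix z assume z: "z \<in> {0..x}"
    show "(g has_field_derivative g' z) (at z within {0..x})"
      by (rule DERIV_subset[OF deriv]) (use z x \<open>e \<le> b\<close> in auto)
    have "\<bar>g' z\<bar> \<le> K * z ^ n"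
      using bound z x by simp
    also have "\<dots> \<le> K * x ^ n"
      using z \<open>K \<ge> 0\<close> by (intro mult_left_mono power_mono) auto
    finally show "norm (g' z) \<le> K * x ^ n" by simp
  qed (use x in auto)
  then show ?thesis
    using \<open>g 0 = 0\<close> x by (simp add: mult_ac)
qed (use \<open>g 0 = 0\<close> in auto)

text \<open>Turns an inequality into an exact factor, so that remainders can enter polynomial
  identities as bounded coefficients.\<close>

lemma taylor_remainder_quotient:
  fixes r :: "real \<Rightarrow> real"
  assumes "r 0 = 0" "\<And>x. x \<in> {0..e} \<Longrightarrow> \<bar>r x\<bar> \<le> K * x ^ n" "n > 0" "K \<ge> 0"
  obtains q where "\<And>x. x \<in> {0..e} \<Longrightarrow> r x = q x * x ^ n" "\<And>x. x \<in> {0..e} \<Longrightarrow> \<bar>q x\<bar> \<le> K"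
proof
  \<comment> \<open>The witness is the quotient itself; at \<open>x = 0\<close> it is 0 because
    \<open>r 0 = 0\<close>.\<close>
  fix x assume x: "x \<in> {0..e}"
  show "r x = r x / x ^ n * x ^ n"
    using assms(1) by (cases "x = 0") auto
  show "\<bar>r x / x ^ n\<bar> \<le> K"
  proof (cases "x = 0")
    case False
    then have "x > 0" using x by auto
    then show ?thesis
      using assms(2)[OF x] by (simp add: divide_le_eq)
  qed (use assms in auto)
qed

text \<open>Serves both regimes: \<open>m = 1\<close> with \<open>d\<close> the fourth derivative at
  0 under a Lipschitz condition there, and \<open>m = 0\<close> with \<open>d = 0\<close> under mere
  boundedness. The bound on the fourth derivative is integrated five times, up to the area, and
  gains one power of \<open>x\<close> each time.\<close>

lemma taylor_expansions:
  fixes f :: "real \<Rightarrow> real"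
  assumes C4: "C_k_on 4 {0..b} f" and "0 \<le> e" "e \<le> b"
    and top: "\<forall>x\<in>{0..e}. \<bar>nth_deriv_on {0..b} 4 f x - d\<bar> \<le> K * x ^ m" and "K \<ge> 0"
  defines "p \<equiv> nth_deriv_on {0..b} 1 f 0"
    and "a \<equiv> nth_deriv_on {0..b} 2 f 0"
    and "c \<equiv> nth_deriv_on {0..b} 3 f 0"
  shows "\<exists>u v w. \<forall>x\<in>{0..e}.
      f x = f 0 + p * x + a / 2 * x ^ 2 + c / 6 * x ^ 3 + d / 24 * x ^ 4 + u x * x ^ (m + 4) \<and>
      nth_deriv_on {0..b} 1 f x = p + a * x + c / 2 * x ^ 2 + d / 6 * x ^ 3 + v x * x ^ (m + 3) \<and>
      integral {0..x} f
        = f 0 * x + p / 2 * x ^ 2 + a / 6 * x ^ 3 + c / 24 * x ^ 4 + d / 120 * x ^ 5 + w x * x ^ (m + 5) \<and>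
      \<bar>u x\<bar> \<le> K \<and> \<bar>v x\<bar> \<le> K \<and> \<bar>w x\<bar> \<le> K"
proof -
  define D where "D i = nth_deriv_on {0..b} i f" for i
  have D0: "D 0 = f"
    by (simp add: D_def nth_deriv_on_def)
  have deriv: "(D i has_real_derivative D (Suc i) x) (at x within {0..b})"
    if "i < 4" "x \<in> {0..b}" for i x
    unfolding D_def using has_real_derivative_nth_deriv_on[OF C4 that] .
  note d = deriv[of 0, simplified D0] deriv[of 1] deriv[of 2] deriv[of 3]
  have "continuous_on {0..b} f"
    using continuous_on_if_C_k_on[OF C4, of 0] D0 by (simp add: D_def)
  then have int: "((\<lambda>x. integral {0..x} f) has_real_derivative f x) (at x within {0..b})"
    if "x \<in> {0..b}" for x
    using integral_has_real_derivative that by blast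
  \<comment> \<open>Each remainder is the derivative of the next one and all vanish at 0, as the
    iterated estimate requires.\<close>
  define R3 where "R3 x = D 3 x - (c + d * x)" for x
  define R2 where "R2 x = D 2 x - (a + c * x + d / 2 * x ^ 2)" for x
  define R1 where "R1 x = D 1 x - (p + a * x + c / 2 * x ^ 2 + d / 6 * x ^ 3)" for x
  define R0 where "R0 x = f x - (f 0 + p * x + a / 2 * x ^ 2 + c / 6 * x ^ 3 + d / 24 * x ^ 4)" for x
  define Ri where "Ri x = integral {0..x} f
    - (f 0 * x + p / 2 * x ^ 2 + a / 6 * x ^ 3 + c / 24 * x ^ 4 + d / 120 * x ^ 5)" for x
  have zero: "R3 0 = 0" "R2 0 = 0" "R1 0 = 0" "R0 0 = 0" "Ri 0 = 0"
    by (auto simp: R3_def R2_def R1_def R0_def Ri_def D_def p_def a_def c_def)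
  have "(R3 has_real_derivative D 4 x - d) (at x within {0..b})"
    "(R2 has_real_derivative R3 x) (at x within {0..b})"
    "(R1 has_real_derivative R2 x) (at x within {0..b})"
    "(R0 has_real_derivative R1 x) (at x within {0..b})"
    "(Ri has_real_derivative R0 x) (at x within {0..b})" if "x \<in> {0..b}" for x
    unfolding R3_def R2_def R1_def R0_def Ri_def
    by (rule derivative_eq_intros d int that refl | simp add: numeral_eq_Suc field_simps that)+
  note step = this[THEN abs_le_power_if_deriv_le_power, OF _ _ \<open>e \<le> b\<close> _ \<open>K \<ge> 0\<close>]
  have "\<bar>R3 x\<bar> \<le> K * x ^ Suc m" if "x \<in> {0..e}" for x
    using step(1)[OF _ zero(1)] top that unfolding D_def by blast
  then have "\<bar>R2 x\<bar> \<le> K * x ^ Suc (Suc m)" if "x \<in> {0..e}" for x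
    using step(2)[OF _ zero(2)] that by blast
  then have 1: "\<bar>R1 x\<bar> \<le> K * x ^ Suc (Suc (Suc m))" if "x \<in> {0..e}" for x
    using step(3)[OF _ zero(3)] that by blast
  then have 0: "\<bar>R0 x\<bar> \<le> K * x ^ Suc (Suc (Suc (Suc m)))" if "x \<in> {0..e}" for x
    using step(4)[OF _ zero(4)] that by blast
  then have i: "\<bar>Ri x\<bar> \<le> K * x ^ Suc (Suc (Suc (Suc (Suc m))))" if "x \<in> {0..e}" for x
    using step(5)[OF _ zero(5)] that by blast
  obtain u where u: "\<And>x. x \<in> {0..e} \<Longrightarrow> R0 x = u x * x ^ (m + 4)" "\<And>x. x \<in> {0..e} \<Longrightarrow> \<bar>u x\<bar> \<le> K"
    using taylor_remainder_quotient[OF zero(4) 0 _ \<open>K \<ge> 0\<close>] by (auto simp: numeral_eq_Suc)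
  obtain v where v: "\<And>x. x \<in> {0..e} \<Longrightarrow> R1 x = v x * x ^ (m + 3)" "\<And>x. x \<in> {0..e} \<Longrightarrow> \<bar>v x\<bar> \<le> K"
    using taylor_remainder_quotient[OF zero(3) 1 _ \<open>K \<ge> 0\<close>] by (auto simp: numeral_eq_Suc)
  obtain w where w: "\<And>x. x \<in> {0..e} \<Longrightarrow> Ri x = w x * x ^ (m + 5)" "\<And>x. x \<in> {0..e} \<Longrightarrow> \<bar>w x\<bar> \<le> K"
    using taylor_remainder_quotient[OF zero(5) i _ \<open>K \<ge> 0\<close>] by (auto simp: numeral_eq_Suc)
  show ?thesis
  proof (rule exI[of _ u], rule exI[of _ v], rule exI[of _ w], intro ballI conjI)
    fix x assume x: "x \<in> {0..e}"
    show "f x = f 0 + p * x + a / 2 * x ^ 2 + c / 6 * x ^ 3 + d / 24 * x ^ 4 + u x * x ^ (m + 4)"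
      using u(1)[OF x] unfolding R0_def by linarith
    show "nth_deriv_on {0..b} 1 f x = p + a * x + c / 2 * x ^ 2 + d / 6 * x ^ 3 + v x * x ^ (m + 3)"
      using v(1)[OF x] unfolding R1_def D_def by linarith
    show "integral {0..x} f
       = f 0 * x + p / 2 * x ^ 2 + a / 6 * x ^ 3 + c / 24 * x ^ 4 + d / 120 * x ^ 5 + w x * x ^ (m + 5)"
      using w(1)[OF x] unfolding Ri_def by linarith
  qed (use u v w in auto)
qed

subsection \<open>The Bezier curve and its area\<close>

lemma fst_bezier:
  "fst (bezier S f h r1 r2 t)
   = r1 * (1 - t)\<^sup>2 * t + 3 * (1 - t) * t\<^sup>2 * (h - r2 / 3) + t ^ 3 * h"
  by (simp add: bezier_def tangent_def chord_def)

lemma snd_bezier: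
  "snd (bezier S f h r1 r2 t)
   = f 0 + r1 * (1 - t)\<^sup>2 * t * nth_deriv_on S 1 f 0
     + 3 * (1 - t) * t\<^sup>2 * (f h - f 0 - r2 / 3 * nth_deriv_on S 1 f h) + t ^ 3 * (f h - f 0)"
  by (simp add: bezier_def tangent_def chord_def)

text \<open>The integral is bilinear in the coefficients, and the pair of \<open>t ^ i\<close> in
  \<open>y\<close> and \<open>t ^ j\<close> in \<open>x\<close> contributes j/(i+j). There is no
  constant term in \<open>x\<close> because the abscissa starts at 0.\<close>

lemma integral_cubic_times_deriv_cubic:
  fixes x y :: "real \<Rightarrow> real"
  assumes x: "\<And>t. x t = x1 * t + x2 * t ^ 2 + x3 * t ^ 3"
    and y: "\<And>t. y t = y0 + y1 * t + y2 * t ^ 2 + y3 * t ^ 3"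
  shows "integral {0..1} (\<lambda>t. y t * deriv x t)
    = y0 * (x1 + x2 + x3) + y1 * (x1 / 2 + 2 * x2 / 3 + 3 * x3 / 4)
      + y2 * (x1 / 3 + x2 / 2 + 3 * x3 / 5) + y3 * (x1 / 4 + 2 * x2 / 5 + x3 / 2)"
proof -
  have "(x has_real_derivative x1 + 2 * x2 * t + 3 * x3 * t ^ 2) (at t)" for t
    unfolding x[abs_def] by (auto intro!: derivative_eq_intros)
  then have deriv: "deriv x t = x1 + 2 * x2 * t + 3 * x3 * t ^ 2" for t
    by (rule DERIV_imp_deriv)
  define A where "A t =
      y0 * (x1 * t + x2 * t ^ 2 + x3 * t ^ 3)
      + y1 * (x1 / 2 * t ^ 2 + 2 * x2 / 3 * t ^ 3 + 3 * x3 / 4 * t ^ 4)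
      + y2 * (x1 / 3 * t ^ 3 + x2 / 2 * t ^ 4 + 3 * x3 / 5 * t ^ 5)
      + y3 * (x1 / 4 * t ^ 4 + 2 * x2 / 5 * t ^ 5 + x3 / 2 * t ^ 6)" for t
  have "(A has_real_derivative y t * deriv x t) (at t within {0..1})" for t
    unfolding A_def deriv y
    by (rule derivative_eq_intros refl | simp)+ (simp add: field_simps eval_nat_numeral)
  then have "((\<lambda>t. y t * deriv x t) has_integral A 1 - A 0) {0..1}"
    by (intro fundamental_theorem_of_calculus)
       (auto simp: has_real_derivative_iff_has_vector_derivative)
  then show ?thesis
    by (simp add: integral_unique A_def)
qed

text \<open>For fixed \<open>r1\<close> the area condition is linear in \<open>r2\<close>, and the
  assumption says that the coefficient of \<open>r2\<close> is nonzero; \<open>r2_of\<close> is then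
  the solution.\<close>

lemma area_preserving_bezier:
  assumes "r1_of P h * cross2 (tangent S f 0) (tangent S f h)
      + 6 * cross2 (tangent S f h) (chord f h) \<noteq> 0"
  shows "area_preserving f h (bezier S f h (r1_of P h) (r2_of S f P h))"
proof -
  define r1 r2 p q k where "r1 = r1_of P h" and "r2 = r2_of S f P h"
    and "p = nth_deriv_on S 1 f 0" and "q = nth_deriv_on S 1 f h" and "k = f h - f 0"
  let ?B = "bezier S f h r1 r2"
  have "r2 * (r1 * (q - p) + 6 * (k - h * q)) = 6 * (10 * secant_area f h - r1 * (h * p - k))"
    using assms unfolding r2_def r2_of_def
    by (simp add: cross2_def tangent_def chord_def r1_def p_def q_def k_def)
  \<comment> \<open>The monomial coefficients of the abscissa are \<open>r1\<close>,
    \<open>3*h - r2 - 2*r1\<close> and \<open>r1 - 3*h + r2 + h\<close>; those of the ordinate arise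
    by weighting \<open>r1\<close> with \<open>p\<close> and \<open>r2\<close> with \<open>q\<close>
    and replacing \<open>h\<close> by \<open>k\<close>.\<close>
  moreover have "integral {0..1} (\<lambda>t. snd (?B t) * deriv (\<lambda>s. fst (?B s)) t)
     = f 0 * (r1 + (3*h - r2 - 2*r1) + (r1 - 3*h + r2 + h))
       + r1*p * (r1 / 2 + 2 * (3*h - r2 - 2*r1) / 3 + 3 * (r1 - 3*h + r2 + h) / 4)
       + (3*k - r2*q - 2*r1*p) * (r1 / 3 + (3*h - r2 - 2*r1) / 2 + 3 * (r1 - 3*h + r2 + h) / 5)
       + (r1*p - 3*k + r2*q + k) * (r1 / 4 + 2 * (3*h - r2 - 2*r1) / 5 + (r1 - 3*h + r2 + h) / 2)"
    by (rule integral_cubic_times_deriv_cubic)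
       (simp_all add: fst_bezier snd_bezier p_def q_def k_def algebra_simps eval_nat_numeral)
  ultimately show ?thesis
    unfolding area_preserving_def r1_def[symmetric] r2_def[symmetric] secant_area_def
    by (simp add: k_def field_simps) 
qed

lemma continuous_on_bezier:
  "continuous_on T (\<lambda>t. fst (bezier S f h r1 r2 t))"
  "continuous_on T (\<lambda>t. snd (bezier S f h r1 r2 t))"
  unfolding fst_bezier snd_bezier by (intro continuous_intros)+

lemma interp_error_bezier_le:
  assumes "continuous_on S f"
    and "\<And>t. t \<in> {0..1} \<Longrightarrow> fst (bezier S f h r1 r2 t) \<in> S"
    and bound: "\<And>t. t \<in> {0..1} \<Longrightarrow>
      \<bar>snd (bezier S f h r1 r2 t) - f (fst (bezier S f h r1 r2 t))\<bar> \<le> E"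
  shows "interp_error f (bezier S f h r1 r2) \<le> ereal E"
  unfolding interp_error_def Linf_norm_def
proof (rule esssup_I)
  \<comment> \<open>Continuity supplies the measurability without which the essential supremum would
    be infinite.\<close>
  have "continuous_on {0..1} (\<lambda>t. \<bar>snd (bezier S f h r1 r2 t) - f (fst (bezier S f h r1 r2 t))\<bar>)"
    using assms(2)
    by (intro continuous_intros continuous_on_bezier continuous_on_compose2[OF assms(1)]) auto
  then show "(\<lambda>t. ereal \<bar>snd (bezier S f h r1 r2 t) - f (fst (bezier S f h r1 r2 t))\<bar>)
    \<in> borel_measurable (lebesgue_on {0..1})"
    by (intro borel_measurable_ereal continuous_imp_measurable_on_sets_lebesgue) auto
  show "AE t in lebesgue_on {0..1}.
      ereal \<bar>snd (bezier S f h r1 r2 t) - f (fst (bezier S f h r1 r2 t))\<bar> \<le> ereal E"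
    using bound by (intro AE_I2) auto
qed

section \<open>Exact formulas for \<open>r2\<close> and for the error\<close>

lemma r2_of_denominator:
  "r * cross2 (tangent S f 0) (tangent S f h) + 6 * cross2 (tangent S f h) (chord f h)
   = (r - 6 * h) * (nth_deriv_on S 1 f h - nth_deriv_on S 1 f 0)
     + 6 * (f h - f 0 - nth_deriv_on S 1 f 0 * h)"
  by (simp add: cross2_def tangent_def chord_def algebra_simps)

text \<open>As in the denominator, everything is grouped into deviations from the tangent line at 0,
  so that \<open>f 0\<close> and the slope cancel once Taylor expansions are inserted.\<close>

lemma r2_of_numerator:
  "10 * secant_area f h - r * cross2 (chord f h) (tangent S f 0)
   = 10 * (integral {0..h} f - f 0 * h - nth_deriv_on S 1 f 0 / 2 * h ^ 2)
     + (r - 5 * h) * (f h - f 0 - nth_deriv_on S 1 f 0 * h)"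
  by (simp add: cross2_def tangent_def chord_def secant_area_def algebra_simps power2_eq_square)

text \<open>Orders 2 and 3 cancel already for \<open>r2 = h\<close>, by cubic Hermite reproduction.
  At order 4 both the shift of the abscissa and the quartic Taylor term are multiples of the same
  polynomial t^2 (1-t)^2, with total coefficient \<open>- (a * (e2 + P) + d / 24)\<close>. A single
  scalar condition on \<open>e2\<close> therefore removes order 4 for all \<open>t\<close> at once,
  up to the factor \<open>h * e3\<close>.\<close>

lemma bezier_error_nonzero_curvature:
  fixes h t :: real
  assumes r1: "r1 = h + P * h ^ 3" and r2: "r2 = h * (1 + h ^ 2 * e2)"
    and e2: "a * (e2 + P) = a * h * e3 - d / 24"
    and s: "s = P * (1 - t)\<^sup>2 * t - e2 * (t\<^sup>2 - t ^ 3)" and X: "X = t + h\<^sup>2 * s"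
    and fh: "f h = f 0 + nth_deriv_on S 1 f 0 * h + a / 2 * h ^ 2 + c / 6 * h ^ 3 + d / 24 * h ^ 4 + u * h ^ 5"
    and qh: "nth_deriv_on S 1 f h = nth_deriv_on S 1 f 0 + a * h + c / 2 * h ^ 2 + d / 6 * h ^ 3 + v * h ^ 4"
    and fx: "f (h * X) = f 0 + nth_deriv_on S 1 f 0 * (h * X) + a / 2 * (h * X) ^ 2 + c / 6 * (h * X) ^ 3
      + d / 24 * (h * X) ^ 4 + \<rho> * (h * X) ^ 5"
  shows "fst (bezier S f h r1 r2 t) = h * X" (is ?fst)
    and "snd (bezier S f h r1 r2 t) - f (fst (bezier S f h r1 r2 t))
      = h ^ 5 * (u * (3 * t\<^sup>2 - 2 * t ^ 3) - (1 + h\<^sup>2 * e2) * v * (t\<^sup>2 - t ^ 3) - \<rho> * X ^ 5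
          - a * e3 * (1 - t)\<^sup>2 * t\<^sup>2 - a / 2 * h * s\<^sup>2
          - c * (e2 / 2 * (t\<^sup>2 - t ^ 3) + s / 6 * (X\<^sup>2 + X * t + t\<^sup>2))
          - h * d * (e2 / 6 * (t\<^sup>2 - t ^ 3) + s / 24 * (X + t) * (X\<^sup>2 + t\<^sup>2)))"
proof -
  show fst: ?fst
    unfolding fst_bezier r1 r2 X s by algebra
  define p where "p = nth_deriv_on S 1 f 0"
  have d: "d = 24 * a * (h * e3 - e2 - P)"
    using e2 by (simp add: algebra_simps)
  have X2: "X ^ 2 = t ^ 2 + 2 * h\<^sup>2 * s * t + h ^ 4 * s ^ 2"
    unfolding X by algebra
  have X3: "X ^ 3 = t ^ 3 + h\<^sup>2 * s * (X\<^sup>2 + X * t + t\<^sup>2)"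
    unfolding X by algebra
  have X4: "X ^ 4 = t ^ 4 + h\<^sup>2 * s * ((X + t) * (X\<^sup>2 + t\<^sup>2))"
    unfolding X by algebra
  \<comment> \<open>The leading part of the quartic term is grouped with the quadratic terms because
    only together do they gain the factor \<open>h ^ 3\<close>.\<close>
  have quadratic: "a / 2 * (3 * t\<^sup>2 - 2 * t ^ 3) - (1 + h\<^sup>2 * e2) * a * (t\<^sup>2 - t ^ 3) - a / 2 * X ^ 2
      + h\<^sup>2 * (d / 24 * (3 * t\<^sup>2 - 2 * t ^ 3) - d / 6 * (t\<^sup>2 - t ^ 3) - d / 24 * t ^ 4)
      = h ^ 3 * (- a * e3 * (1 - t)\<^sup>2 * t\<^sup>2 - a / 2 * h * s\<^sup>2)"
    unfolding X2 d s by (simp add: field_simps) algebra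
  \<comment> \<open>With \<open>X = t\<close> and \<open>e2 = 0\<close> the left side would vanish;
    what is left is of relative order \<open>h\<^sup>2\<close> through \<open>e2\<close> and
    \<open>X ^ 3 - t ^ 3\<close>.\<close>
  have cubic: "c / 6 * h * (3 * t\<^sup>2 - 2 * t ^ 3) - (1 + h\<^sup>2 * e2) * c / 2 * h * (t\<^sup>2 - t ^ 3) - c / 6 * h * X ^ 3
      = h ^ 3 * (- c * (e2 / 2 * (t\<^sup>2 - t ^ 3) + s / 6 * (X\<^sup>2 + X * t + t\<^sup>2)))"
    unfolding X3 by (simp add: field_simps) algebra
  have quartic: "- h\<^sup>2 * e2 * d / 6 * h\<^sup>2 * (t\<^sup>2 - t ^ 3) - d / 24 * h\<^sup>2 * (X ^ 4 - t ^ 4)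
      = h ^ 3 * (- h * d * (e2 / 6 * (t\<^sup>2 - t ^ 3) + s / 24 * (X + t) * (X\<^sup>2 + t\<^sup>2)))"
    unfolding X4 by (simp add: field_simps) algebra
  have "snd (bezier S f h r1 r2 t) - f (h * X)
    = (f h - f 0 - p * h) * (3 * t\<^sup>2 - 2 * t ^ 3) - r2 * (nth_deriv_on S 1 f h - p) * (t\<^sup>2 - t ^ 3)
      - (f (h * X) - f 0 - p * (h * X))"
    unfolding fst[symmetric] snd_bezier fst_bezier p_def[symmetric] by algebra
  also have "\<dots> = h\<^sup>2 * (
      (a / 2 * (3 * t\<^sup>2 - 2 * t ^ 3) - (1 + h\<^sup>2 * e2) * a * (t\<^sup>2 - t ^ 3) - a / 2 * X ^ 2
      + h\<^sup>2 * (d / 24 * (3 * t\<^sup>2 - 2 * t ^ 3) - d / 6 * (t\<^sup>2 - t ^ 3) - d / 24 * t ^ 4))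
      + (c / 6 * h * (3 * t\<^sup>2 - 2 * t ^ 3) - (1 + h\<^sup>2 * e2) * c / 2 * h * (t\<^sup>2 - t ^ 3) - c / 6 * h * X ^ 3)
      + (- h\<^sup>2 * e2 * d / 6 * h\<^sup>2 * (t\<^sup>2 - t ^ 3) - d / 24 * h\<^sup>2 * (X ^ 4 - t ^ 4))
      + h ^ 3 * (u * (3 * t\<^sup>2 - 2 * t ^ 3) - (1 + h\<^sup>2 * e2) * v * (t\<^sup>2 - t ^ 3) - \<rho> * X ^ 5))"
    unfolding fh fx qh r2 p_def by (simp add: field_simps) algebra
  also have "\<dots> = h ^ 5 * (u * (3 * t\<^sup>2 - 2 * t ^ 3) - (1 + h\<^sup>2 * e2) * v * (t\<^sup>2 - t ^ 3) - \<rho> * X ^ 5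
          - a * e3 * (1 - t)\<^sup>2 * t\<^sup>2 - a / 2 * h * s\<^sup>2
          - c * (e2 / 2 * (t\<^sup>2 - t ^ 3) + s / 6 * (X\<^sup>2 + X * t + t\<^sup>2))
          - h * d * (e2 / 6 * (t\<^sup>2 - t ^ 3) + s / 24 * (X + t) * (X\<^sup>2 + t\<^sup>2)))"
    unfolding quadratic cubic quartic by algebra
  finally show "snd (bezier S f h r1 r2 t) - f (fst (bezier S f h r1 r2 t)) = \<dots>"
    unfolding fst .
qed

text \<open>The closeness of \<open>q\<close> to 1 enters only through the product
  \<open>c * q\<close>. Hence the identity also covers \<open>c = 0\<close>, where
  \<open>k = 0\<close> is possible with any \<open>q\<close>.\<close>

lemma bezier_error_zero_curvature:
  fixes h t :: real
  assumes r1: "r1 = h + P * h ^ 3" and r2: "r2 = h * q"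
    and k: "c * q = c + h * k"
    and \<sigma>: "\<sigma> = c * h * P * (1 - t)\<^sup>2 * t - k * (t\<^sup>2 - t ^ 3)"
    and X: "X = t + h\<^sup>2 * P * (1 - t)\<^sup>2 * t - (q - 1) * (t\<^sup>2 - t ^ 3)"
    and fh: "f h = f 0 + nth_deriv_on S 1 f 0 * h + c / 6 * h ^ 3 + u * h ^ 4"
    and qh: "nth_deriv_on S 1 f h = nth_deriv_on S 1 f 0 + c / 2 * h ^ 2 + v * h ^ 3"
    and fx: "f (h * X) = f 0 + nth_deriv_on S 1 f 0 * (h * X) + c / 6 * (h * X) ^ 3 + \<rho> * (h * X) ^ 4"
  shows "fst (bezier S f h r1 r2 t) = h * X" (is ?fst)
    and "snd (bezier S f h r1 r2 t) - f (fst (bezier S f h r1 r2 t))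
      = h ^ 4 * (u * (3 * t\<^sup>2 - 2 * t ^ 3) - q * v * (t\<^sup>2 - t ^ 3) - \<rho> * X ^ 4
          - k / 2 * (t\<^sup>2 - t ^ 3) - \<sigma> / 6 * (X\<^sup>2 + X * t + t\<^sup>2))"
proof -
  show fst: ?fst
    unfolding fst_bezier r1 r2 X by algebra
  define p where "p = nth_deriv_on S 1 f 0"
  \<comment> \<open>\<open>X - t\<close> itself may fail to be small; multiplied by \<open>c\<close>
    it is of order \<open>h\<close>.\<close>
  have "c * (X - t) = h * \<sigma>"
    using k unfolding X \<sigma> by algebra
  then have X3: "c * X ^ 3 = c * t ^ 3 + h * \<sigma> * (X\<^sup>2 + X * t + t\<^sup>2)"
    by algebra
  have "snd (bezier S f h r1 r2 t) - f (h * X)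
    = (f h - f 0 - p * h) * (3 * t\<^sup>2 - 2 * t ^ 3) - r2 * (nth_deriv_on S 1 f h - p) * (t\<^sup>2 - t ^ 3)
      - (f (h * X) - f 0 - p * (h * X))"
    unfolding fst[symmetric] snd_bezier fst_bezier p_def[symmetric] by algebra
  also have "\<dots> = h ^ 3 * ((c * (3 * t\<^sup>2 - 2 * t ^ 3) - 3 * (c * q) * (t\<^sup>2 - t ^ 3) - c * X ^ 3) / 6
      + h * (u * (3 * t\<^sup>2 - 2 * t ^ 3) - q * v * (t\<^sup>2 - t ^ 3) - \<rho> * X ^ 4))"
    unfolding fh fx qh r2 p_def by (simp add: field_simps) algebra
  also have "\<dots> = h ^ 4 * (u * (3 * t\<^sup>2 - 2 * t ^ 3) - q * v * (t\<^sup>2 - t ^ 3) - \<rho> * X ^ 4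
          - k / 2 * (t\<^sup>2 - t ^ 3) - \<sigma> / 6 * (X\<^sup>2 + X * t + t\<^sup>2))"
    unfolding X3 k by (simp add: field_simps) algebra
  finally show "snd (bezier S f h r1 r2 t) - f (fst (bezier S f h r1 r2 t)) = \<dots>"
    unfolding fst .
qed

subsection \<open>Uniform boundedness\<close>

lemma bounded_bigo_1:
  fixes g :: "'a \<Rightarrow> real"
  assumes "\<forall>\<^sub>F x in F. \<bar>g x\<bar> \<le> K"
  shows "g \<in> O[F](\<lambda>_. 1)"
  using assms by (intro bigoI[of _ K]) simp

lemma bigo_1_power:
  fixes g :: "'a \<Rightarrow> real"
  assumes "g \<in> O[F](\<lambda>_. 1)"
  shows "(\<lambda>x. g x ^ n) \<in> O[F](\<lambda>_. 1)"
  using landau_o.big_power[OF assms, of n] by simp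

lemma bigo_1_divide_const:
  fixes g :: "'a \<Rightarrow> real"
  assumes "g \<in> O[F](\<lambda>_. 1)"
  shows "(\<lambda>x. g x / c) \<in> O[F](\<lambda>_. 1)"
  using landau_o.big.mult_in_1[OF assms bigo_const[of "inverse c"]] by (simp add: divide_inverse)

text \<open>Bounded functions are closed under the ring operations, so boundedness of any polynomial
  expression follows from its shape.\<close>

lemmas bigo_1_intros =
  bigo_const sum_in_bigo landau_o.big.mult_in_1 bigo_1_power bigo_1_divide_const

lemma bigo_1_fst:
  fixes g :: "'a \<Rightarrow> real"
  assumes "g \<in> O[F](\<lambda>_. 1)"
  shows "(\<lambda>\<omega>. g (fst \<omega>)) \<in> O[F \<times>\<^sub>F H](\<lambda>_. 1)"
  by (rule landau_o.big.compose[OF assms filterlim_fst])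

lemma eventually_fst:
  "eventually P F \<Longrightarrow> \<forall>\<^sub>F \<omega> in F \<times>\<^sub>F H. P (fst \<omega>)"
  by (rule eventually_compose_filterlim[OF _ filterlim_fst])

lemma eventually_snd_principal: "\<forall>\<^sub>F \<omega> in F \<times>\<^sub>F principal T. snd \<omega> \<in> T"
  by (rule eventually_compose_filterlim[OF _ filterlim_snd]) (simp add: eventually_principal)

text \<open>Every set in the principal factor contains all of \<open>T\<close>, so one threshold for
  \<open>h\<close> serves all \<open>t\<close>. This is how uniformity in \<open>t\<close> is
  encoded below.\<close>

lemma eventually_prod_principalD:
  assumes "\<forall>\<^sub>F \<omega> in F \<times>\<^sub>F principal T. R (fst \<omega>) (snd \<omega>)"
  shows "\<forall>\<^sub>F h in F. \<forall>t\<in>T. R h t"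
  using assms by (force simp: eventually_prod_filter eventually_principal elim: eventually_mono)

lemma bigo_1_snd_unit_interval: "snd \<in> O[F \<times>\<^sub>F principal {0..1::real}](\<lambda>_. 1)"
  by (rule bounded_bigo_1[where K = 1], rule eventually_mono[OF eventually_snd_principal]) auto

text \<open>\<open>G\<close> may be finer than \<open>at_right 0\<close> because the zero curvature
  case takes limits along admissible \<open>h\<close> only.\<close>

lemma tendsto_perturbation:
  fixes B :: "real \<Rightarrow> real"
  assumes "G \<le> at_right 0" "B \<in> O[G](\<lambda>_. 1)"
  shows "((\<lambda>h. m + h * B h) \<longlongrightarrow> m) G"
proof -
  have lim: "((\<lambda>h. h) \<longlongrightarrow> 0) G"
    using assms(1) by (rule tendsto_mono) (auto intro: tendsto_intros)
  obtain K where "K > 0" "\<forall>\<^sub>F h in G. \<bar>B h\<bar> \<le> K"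
    using assms(2) by (auto elim: landau_o.bigE)
  then have "\<forall>\<^sub>F h in G. norm (h * B h) \<le> K * \<bar>h\<bar>"
    by (auto elim!: eventually_mono simp: abs_mult mult.commute[of K] mult_left_mono)
  moreover have "((\<lambda>h. K * \<bar>h\<bar>) \<longlongrightarrow> 0) G"
    using tendsto_mult_left[OF tendsto_rabs[OF lim], of K] by simp
  ultimately have "((\<lambda>h. h * B h) \<longlongrightarrow> 0) G"
    by (rule Lim_null_comparison)
  from tendsto_add[OF tendsto_const[of m] this] show ?thesis
    by simp
qed

lemma tendsto_nonzero_bigo_1_inverse:
  fixes M :: "real \<Rightarrow> real"
  assumes "(M \<longlongrightarrow> m) G" "m \<noteq> 0"
  shows "(\<lambda>h. inverse (M h)) \<in> O[G](\<lambda>_. 1)" "\<forall>\<^sub>F h in G. M h \<noteq> 0"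
proof -
  show "\<forall>\<^sub>F h in G. M h \<noteq> 0"
    using assms by (rule tendsto_imp_eventually_ne)
  have "((\<lambda>h. \<bar>inverse (M h)\<bar>) \<longlongrightarrow> \<bar>inverse m\<bar>) G"
    using assms by (intro tendsto_intros)
  then have "\<forall>\<^sub>F h in G. \<bar>inverse (M h)\<bar> < \<bar>inverse m\<bar> + 1"
    by (rule order_tendstoD) simp
  then show "(\<lambda>h. inverse (M h)) \<in> O[G](\<lambda>_. 1)"
    by (intro bounded_bigo_1[where K = "\<bar>inverse m\<bar> + 1"]) (auto elim: eventually_mono)
qed

text \<open>Converts a factorization of the error with bounded cofactor \<open>Q\<close> on the
  product filter into the sup bound over \<open>t\<close>.\<close>

lemma bigo_1_uniformly:
  fixes E :: "'a \<Rightarrow> 'b \<Rightarrow> real"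
  assumes "Q \<in> O[F \<times>\<^sub>F principal T](\<lambda>_. 1)"
    and "\<forall>\<^sub>F \<omega> in F \<times>\<^sub>F principal T. E (fst \<omega>) (snd \<omega>) = r (fst \<omega>) * Q \<omega>"
  obtains C where "\<forall>\<^sub>F h in F. \<forall>t\<in>T. \<bar>E h t\<bar> \<le> C * \<bar>r h\<bar>"
proof -
  obtain C where "\<forall>\<^sub>F \<omega> in F \<times>\<^sub>F principal T. \<bar>Q \<omega>\<bar> \<le> C"
    using assms(1) by (auto elim: landau_o.bigE)
  with assms(2) have "\<forall>\<^sub>F \<omega> in F \<times>\<^sub>F principal T. \<bar>E (fst \<omega>) (snd \<omega>)\<bar> \<le> C * \<bar>r (fst \<omega>)\<bar>"
    by eventually_elim (simp add: abs_mult mult_right_mono mult.commute)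
  then have "\<forall>\<^sub>F h in F. \<forall>t\<in>T. \<bar>E h t\<bar> \<le> C * \<bar>r h\<bar>"
    by (rule eventually_prod_principalD)
  then show ?thesis ..
qed

lemma graph_curvature_eq_0_iff: "graph_curvature S f x = 0 \<longleftrightarrow> nth_deriv_on S 2 f x = 0"
proof -
  have "1 + (nth_deriv_on S 1 f x)\<^sup>2 > 0"
    by (simp add: add_pos_nonneg)
  then show ?thesis
    by (auto simp: graph_curvature_def)
qed

subsection \<open>Nonvanishing curvature\<close>

text \<open>The Lipschitz condition at 0 raises the Taylor remainder from o(h^4) to O(h^5).
  Admissibility is proved, not assumed: since \<open>a\<close> is nonzero, \<open>r1 / h\<close> and
  \<open>r2 / h\<close> tend to 1 and the abscissa is a small perturbation of
  \<open>h * t\<close>.\<close>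

lemma interpolation_nonzero_curvature:
  fixes f :: "real \<Rightarrow> real"
  assumes "0 < b" and C4: "C_k_on 4 {0..b} f"
    and Lipschitz: "(\<lambda>x. nth_deriv_on {0..b} 4 f x - nth_deriv_on {0..b} 4 f 0) \<in> O[at_right 0](\<lambda>x. x)"
    and curvature: "nth_deriv_on {0..b} 2 f 0 \<noteq> 0"
  shows "\<exists>C. \<forall>\<^sub>F h in at_right 0.
    area_preserving_interpolant {0..b} f h (r1_of P h) (r2_of {0..b} f P h) \<and>
    interp_error f (bezier {0..b} f h (r1_of P h) (r2_of {0..b} f P h)) \<le> ereal (C * h ^ 5)"
proof -
  define p a c d where "p = nth_deriv_on {0..b} 1 f 0" and "a = nth_deriv_on {0..b} 2 f 0"
    and "c = nth_deriv_on {0..b} 3 f 0" and "d = nth_deriv_on {0..b} 4 f 0"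
  have "a \<noteq> 0" using curvature by (simp add: a_def)
  have cont: "continuous_on {0..b} f"
    using continuous_on_if_C_k_on[OF C4, of 0] by (simp add: nth_deriv_on_def)
  obtain K where "K > 0" and K: "\<forall>\<^sub>F x in at_right 0. \<bar>nth_deriv_on {0..b} 4 f x - d\<bar> \<le> K * \<bar>x\<bar>"
    using Lipschitz by (auto simp: d_def elim: landau_o.bigE)
  obtain e' where "e' > 0" and e': "\<And>x. 0 < x \<Longrightarrow> x < e' \<Longrightarrow> \<bar>nth_deriv_on {0..b} 4 f x - d\<bar> \<le> K * \<bar>x\<bar>"
    using K unfolding eventually_at_right_field by blast
  \<comment> \<open>Halving \<open>e'\<close> puts the closed interval \<open>{0..e}\<close> inside
    the range of the strict bound.\<close>
  define e where "e = min b (e' / 2)"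
  have e: "0 < e" "e \<le> b" using \<open>0 < b\<close> \<open>e' > 0\<close> by (auto simp: e_def)
  have "\<forall>x\<in>{0..e}. \<bar>nth_deriv_on {0..b} 4 f x - d\<bar> \<le> K * x ^ 1"
  proof
    fix x assume "x \<in> {0..e}"
    then show "\<bar>nth_deriv_on {0..b} 4 f x - d\<bar> \<le> K * x ^ 1"
      using e'[of x] \<open>e' > 0\<close> by (cases "x = 0") (auto simp: e_def d_def)
  qed
  note taylor = taylor_expansions[OF C4 less_imp_le[OF \<open>0 < e\<close>] \<open>e \<le> b\<close> this
      less_imp_le[OF \<open>K > 0\<close>], folded p_def a_def c_def, unfolded one_plus_numeral add_num_simps]
  then obtain u v w where expansions: "\<forall>x\<in>{0..e}.
      f x = f 0 + p * x + a / 2 * x ^ 2 + c / 6 * x ^ 3 + d / 24 * x ^ 4 + u x * x ^ 5 \<and>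
      nth_deriv_on {0..b} 1 f x = p + a * x + c / 2 * x ^ 2 + d / 6 * x ^ 3 + v x * x ^ 4 \<and>
      integral {0..x} f
        = f 0 * x + p / 2 * x ^ 2 + a / 6 * x ^ 3 + c / 24 * x ^ 4 + d / 120 * x ^ 5 + w x * x ^ 6 \<and>
      \<bar>u x\<bar> \<le> K \<and> \<bar>v x\<bar> \<le> K \<and> \<bar>w x\<bar> \<le> K"
    by (elim exE) (rule that)
  note f_eq = expansions[THEN bspec, THEN conjunct1]
    and f'_eq = expansions[THEN bspec, THEN conjunct2, THEN conjunct1]
    and int_eq = expansions[THEN bspec, THEN conjunct2, THEN conjunct2, THEN conjunct1]
    and bounds = expansions[THEN bspec, THEN conjunct2, THEN conjunct2, THEN conjunct2, THEN conjunct1]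
      expansions[THEN bspec, THEN conjunct2, THEN conjunct2, THEN conjunct2, THEN conjunct2, THEN conjunct1]
      expansions[THEN bspec, THEN conjunct2, THEN conjunct2, THEN conjunct2, THEN conjunct2, THEN conjunct2]
  \<comment> \<open>Found by comparing \<open>h ^ 5\<close> coefficients of six times the numerator
    and of \<open>h ^ 3 * M h\<close>: they differ by \<open>2 * a * P + d / 12\<close>, which is
    \<open>2 * a * (P + \<delta>)\<close>.\<close>
  define \<delta> where "\<delta> = d / (24 * a)"
  let ?G = "at_right (0::real)"
  \<comment> \<open>The denominator of \<open>r2\<close> is \<open>h ^ 2 * M h\<close>, the
    numerator is \<open>h ^ 3 * (M h - h\<^sup>2 * (P + \<delta>) * M h + h ^ 3 * Z h)\<close>.
    Their quotient is \<open>h * (1 + h ^ 2 * e2 h)\<close>, and \<open>M h\<close> stays away from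
    0.\<close>
  define B where "B h = - 3 / 2 * c - 7 / 12 * d * h + (6 * u h - 5 * v h) * h ^ 2
    + P * h * (a + c / 2 * h + d / 6 * h ^ 2 + v h * h ^ 3)" for h
  define M where "M h = - 2 * a + h * B h" for h
  define Z where "Z h = 60 * w h - 30 * u h + 5 * v h
    + P * (c / 2 + d / 12 * h + (6 * u h - v h) * h ^ 2) + (P + \<delta>) * B h" for h
  define e3 where "e3 h = Z h * inverse (M h)" for h
  define e2 where "e2 h = - (P + \<delta>) + h * e3 h" for h
  have small: "\<forall>\<^sub>F h in ?G. h < x" if "x > 0" for x
    using that by (auto simp: eventually_at_right_field)
  have pos: "\<forall>\<^sub>F h in ?G. h > 0"
    by (auto simp: eventually_at_right_less)
  have "\<forall>\<^sub>F h in ?G. \<bar>h\<bar> \<le> 1"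
    using small[OF zero_less_one] pos by eventually_elim auto
  then have h: "(\<lambda>h. h) \<in> O[?G](\<lambda>_. 1)"
    by (rule bounded_bigo_1)
  have in_e: "\<forall>\<^sub>F h in ?G. h \<in> {0..e}"
    using small[OF \<open>0 < e\<close>] pos by eventually_elim auto
  have u: "u \<in> O[?G](\<lambda>_. 1)" and v: "v \<in> O[?G](\<lambda>_. 1)" and w: "w \<in> O[?G](\<lambda>_. 1)"
    by (rule bounded_bigo_1, rule eventually_mono[OF in_e], rule bounds, assumption)+
  have B: "B \<in> O[?G](\<lambda>_. 1)"
    unfolding B_def by (intro bigo_1_intros h u v)
  have M: "(M \<longlongrightarrow> - 2 * a) ?G"
    unfolding M_def by (rule tendsto_perturbation[OF order_refl B])
  have "- 2 * a \<noteq> 0" using \<open>a \<noteq> 0\<close> by simp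
  note invM = tendsto_nonzero_bigo_1_inverse[OF M this]
  have e3: "e3 \<in> O[?G](\<lambda>_. 1)"
    unfolding e3_def Z_def by (intro bigo_1_intros h u v w B invM)
  have e2: "e2 \<in> O[?G](\<lambda>_. 1)"
    unfolding e2_def by (intro bigo_1_intros h e3)
  have r2: "\<forall>\<^sub>F h in ?G. r2_of {0..b} f P h = h * (1 + h ^ 2 * e2 h)
      \<and> area_preserving f h (bezier {0..b} f h (r1_of P h) (r2_of {0..b} f P h))"
    using pos in_e invM(2)
  proof eventually_elim
    fix h assume "h > 0" and h: "h \<in> {0..e}" and "M h \<noteq> 0"
    have den: "r1_of P h * cross2 (tangent {0..b} f 0) (tangent {0..b} f h)
        + 6 * cross2 (tangent {0..b} f h) (chord f h) = h ^ 2 * M h"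
      unfolding r2_of_denominator f_eq[OF h] f'_eq[OF h] r1_of_def M_def B_def p_def[symmetric]
      by (simp add: field_simps) algebra
    have "6 * (10 * secant_area f h - r1_of P h * cross2 (chord f h) (tangent {0..b} f 0))
        = h ^ 3 * (M h - h\<^sup>2 * (P + \<delta>) * M h + h ^ 3 * Z h)"
      unfolding r2_of_numerator f_eq[OF h] int_eq[OF h] r1_of_def Z_def M_def B_def p_def[symmetric] \<delta>_def
      using \<open>a \<noteq> 0\<close> by (simp add: field_simps) algebra
    then have "r2_of {0..b} f P h = h ^ 3 * (M h - h\<^sup>2 * (P + \<delta>) * M h + h ^ 3 * Z h) / (h ^ 2 * M h)"
      unfolding r2_of_def den by simp
    also have "\<dots> = h * (1 + h ^ 2 * e2 h)"
      unfolding e2_def e3_def using \<open>M h \<noteq> 0\<close> \<open>h > 0\<close> by (simp add: field_simps eval_nat_numeral)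
    finally show "r2_of {0..b} f P h = h * (1 + h ^ 2 * e2 h)
      \<and> area_preserving f h (bezier {0..b} f h (r1_of P h) (r2_of {0..b} f P h))"
      using area_preserving_bezier[of P h "{0..b}" f] den \<open>M h \<noteq> 0\<close> \<open>h > 0\<close> by simp
  qed

  let ?F = "?G \<times>\<^sub>F principal {0..1::real}"
  define s where "s \<omega> = P * (1 - snd \<omega>)\<^sup>2 * snd \<omega> - e2 (fst \<omega>) * ((snd \<omega>)\<^sup>2 - snd \<omega> ^ 3)" for \<omega>
  define X where "X \<omega> = snd \<omega> + (fst \<omega>)\<^sup>2 * s \<omega>" for \<omega>
  \<comment> \<open>\<open>y\<close> is \<open>s\<close> with a factor \<open>t\<close> removed, so
    that \<open>X = t * (1 + h\<^sup>2 * y)\<close> is visibly nonnegative down to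
    \<open>t = 0\<close>.\<close>
  define y where "y \<omega> = P * (1 - snd \<omega>)\<^sup>2 - e2 (fst \<omega>) * (snd \<omega> - (snd \<omega>)\<^sup>2)" for \<omega>
  note t = bigo_1_snd_unit_interval[of ?G]
  note h' = bigo_1_fst[OF h] and u' = bigo_1_fst[OF u] and v' = bigo_1_fst[OF v]
    and e2' = bigo_1_fst[OF e2] and e3' = bigo_1_fst[OF e3]
  have s: "s \<in> O[?F](\<lambda>_. 1)" and y: "y \<in> O[?F](\<lambda>_. 1)"
    unfolding s_def y_def by (intro bigo_1_intros t e2')+
  have X: "X \<in> O[?F](\<lambda>_. 1)"
    unfolding X_def by (intro bigo_1_intros t s h')
  obtain L where "L > 0" and L: "\<forall>\<^sub>F \<omega> in ?F. \<bar>y \<omega>\<bar> \<le> L"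
    using y by (auto elim: landau_o.bigE)
  have "((\<lambda>h. h\<^sup>2 * L) \<longlongrightarrow> 0) ?G"
    by (auto intro!: tendsto_eq_intros)
  then have "\<forall>\<^sub>F h in ?G. h\<^sup>2 * L < 1"
    by (rule order_tendstoD) simp
  then have "\<forall>\<^sub>F \<omega> in ?F. (fst \<omega>)\<^sup>2 * L < 1"
    by (rule eventually_fst)
  \<comment> \<open>Below, \<open>X\<close> is bounded by 2 only, so \<open>h\<close> must stay
    below \<open>e / 2\<close> for \<open>h * X\<close> to remain where the expansions hold.\<close>
  moreover have "\<forall>\<^sub>F \<omega> in ?F. fst \<omega> < e / 2"
    by (rule eventually_fst[OF small]) (use \<open>0 < e\<close> in simp)
  ultimately have X_in: "\<forall>\<^sub>F \<omega> in ?F. fst \<omega> * X \<omega> \<in> {0..e}"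
    using L eventually_fst[OF pos] eventually_snd_principal
  proof eventually_elim
    case (elim \<omega>)
    have "\<bar>(fst \<omega>)\<^sup>2 * y \<omega>\<bar> \<le> (fst \<omega>)\<^sup>2 * L"
      using elim by (simp add: abs_mult mult_left_mono)
    then have "\<bar>(fst \<omega>)\<^sup>2 * y \<omega>\<bar> \<le> 1" using elim by linarith
    then have *: "0 \<le> 1 + (fst \<omega>)\<^sup>2 * y \<omega>" "1 + (fst \<omega>)\<^sup>2 * y \<omega> \<le> 2" by linarith+
    have "X \<omega> = snd \<omega> * (1 + (fst \<omega>)\<^sup>2 * y \<omega>)"
      unfolding X_def s_def y_def by algebra
    moreover have "snd \<omega> * (1 + (fst \<omega>)\<^sup>2 * y \<omega>) \<le> 1 * 2"
      using * elim by (intro mult_mono) auto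
    ultimately have "0 \<le> X \<omega>" "X \<omega> \<le> 2" using * elim by simp_all
    moreover from this have "fst \<omega> * X \<omega> \<le> e / 2 * 2"
      using elim by (intro mult_mono) auto
    ultimately show ?case using elim by simp
  qed
  have \<rho>: "(\<lambda>\<omega>. u (fst \<omega> * X \<omega>)) \<in> O[?F](\<lambda>_. 1)"
    by (rule bounded_bigo_1, rule eventually_mono[OF X_in], rule bounds, assumption)
  define Q where "Q \<omega> = (let h = fst \<omega>; t = snd \<omega> in
      u h * (3 * t\<^sup>2 - 2 * t ^ 3) - (1 + h\<^sup>2 * e2 h) * v h * (t\<^sup>2 - t ^ 3) - u (h * X \<omega>) * X \<omega> ^ 5
      - a * e3 h * (1 - t)\<^sup>2 * t\<^sup>2 - a / 2 * h * (s \<omega>)\<^sup>2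
      - c * (e2 h / 2 * (t\<^sup>2 - t ^ 3) + s \<omega> / 6 * ((X \<omega>)\<^sup>2 + X \<omega> * t + t\<^sup>2))
      - h * d * (e2 h / 6 * (t\<^sup>2 - t ^ 3) + s \<omega> / 24 * (X \<omega> + t) * ((X \<omega>)\<^sup>2 + t\<^sup>2)))" for \<omega>
  have Q: "Q \<in> O[?F](\<lambda>_. 1)"
    unfolding Q_def Let_def by (intro bigo_1_intros t s X h' u' v' e2' e3' \<rho>)
  let ?B = "\<lambda>h. bezier {0..b} f h (r1_of P h) (r2_of {0..b} f P h)"
  have curve: "\<forall>\<^sub>F \<omega> in ?F. fst (?B (fst \<omega>) (snd \<omega>)) = fst \<omega> * X \<omega> \<and>
      snd (?B (fst \<omega>) (snd \<omega>)) - f (fst (?B (fst \<omega>) (snd \<omega>))) = fst \<omega> ^ 5 * Q \<omega>"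
    using X_in eventually_fst[OF in_e] eventually_fst[OF r2]
  proof eventually_elim
    case (elim \<omega>)
    obtain h t where \<omega>: "\<omega> = (h, t)" by fastforce
    have r2: "r2_of {0..b} f P h = h * (1 + h\<^sup>2 * e2 h)" and h: "h \<in> {0..e}"
      and x: "h * X (h, t) \<in> {0..e}"
      using elim unfolding \<omega> by simp_all
    have e2: "a * (e2 h + P) = a * h * e3 h - d / 24"
      using \<open>a \<noteq> 0\<close> by (simp add: e2_def \<delta>_def field_simps)
    have s: "s (h, t) = P * (1 - t)\<^sup>2 * t - e2 h * (t\<^sup>2 - t ^ 3)"
      and X: "X (h, t) = t + h\<^sup>2 * s (h, t)"
      by (simp_all add: s_def X_def)
    note error = bezier_error_nonzero_curvature[OF r1_of_def r2 e2 s X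
        f_eq[OF h, unfolded p_def] f'_eq[OF h, unfolded p_def] f_eq[OF x, unfolded p_def]]
    show ?case
      unfolding \<omega> fst_conv snd_conv Q_def Let_def by (intro conjI error)
  qed
  obtain C where C: "\<forall>\<^sub>F h in ?G. \<forall>t\<in>{0..1}. \<bar>snd (?B h t) - f (fst (?B h t))\<bar> \<le> C * \<bar>h ^ 5\<bar>"
    by (rule bigo_1_uniformly[OF Q, where r = "\<lambda>h. h ^ 5"
          and E = "\<lambda>h t. snd (?B h t) - f (fst (?B h t))"])
       (rule eventually_mono[OF curve], erule conjunct2, rule that)
  have "\<forall>\<^sub>F \<omega> in ?F. fst (?B (fst \<omega>) (snd \<omega>)) \<in> {0..b}"
    using curve X_in by eventually_elim (use e in auto)
  then have range: "\<forall>\<^sub>F h in ?G. \<forall>t\<in>{0..1}. fst (?B h t) \<in> {0..b}"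
    by (rule eventually_prod_principalD)
  \<comment> \<open>These are \<open>r2 / h\<close> and \<open>r1 / h\<close>; their limit 1 makes
    both parameters positive.\<close>
  have "((\<lambda>h. 1 + h * (h * e2 h)) \<longlongrightarrow> 1) ?G" "((\<lambda>h. 1 + h * (h * P)) \<longlongrightarrow> 1) ?G"
    by (intro tendsto_perturbation order_refl bigo_1_intros h e2)+
  from this[THEN order_tendstoD(1), of 0]
  have "\<forall>\<^sub>F h in ?G. 0 < 1 + h * (h * e2 h)" "\<forall>\<^sub>F h in ?G. 0 < 1 + h * (h * P)"
    by simp_all
  with C range r2 pos have final: "\<forall>\<^sub>F h in ?G.
    area_preserving_interpolant {0..b} f h (r1_of P h) (r2_of {0..b} f P h) \<and>
    interp_error f (?B h) \<le> ereal (C * h ^ 5)"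
  proof eventually_elim
    case (elim h)
    have "r1_of P h = h * (1 + h * (h * P))"
      by (simp add: r1_of_def algebra_simps eval_nat_numeral)
    then have r1: "r1_of P h > 0" using elim(4,6) by simp
    have r2: "r2_of {0..b} f P h > 0"
      using elim(3-5) by (simp add: power2_eq_square mult.assoc)
    have abs_h: "\<bar>h ^ 5\<bar> = h ^ 5" using elim(4) by simp
    have error: "interp_error f (?B h) \<le> ereal (C * h ^ 5)"
      by (rule interp_error_bezier_le[OF cont])
         (erule bspec[OF elim(2)], erule bspec[OF elim(1)[unfolded abs_h]])
    show ?case
      unfolding area_preserving_interpolant_def
      by (intro conjI) (fact r1 r2 error elim(2) elim(3)[THEN conjunct2])+
  qed
  show ?thesis
    by (rule exI[of _ C], rule final)
qed

subsection \<open>Vanishing curvature\<close>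

text \<open>Admissibility is a hypothesis here, as it can fail: for a straight line the denominator
  of \<open>r2\<close> is 0. It is also a source of bounds, on \<open>r2\<close> and on the
  abscissae.\<close>

lemma interpolation_zero_curvature:
  fixes f :: "real \<Rightarrow> real"
  assumes "0 < b" and C4: "C_k_on 4 {0..b} f"
    and curvature: "nth_deriv_on {0..b} 2 f 0 = 0"
  shows "\<exists>C. \<forall>\<^sub>F h in at_right 0.
    area_preserving_interpolant {0..b} f h (r1_of P h) (r2_of {0..b} f P h) \<longrightarrow>
    interp_error f (bezier {0..b} f h (r1_of P h) (r2_of {0..b} f P h)) \<le> ereal (C * h ^ 4)"
proof -
  define p c where "p = nth_deriv_on {0..b} 1 f 0" and "c = nth_deriv_on {0..b} 3 f 0"
  have cont: "continuous_on {0..b} f"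
    using continuous_on_if_C_k_on[OF C4, of 0] by (simp add: nth_deriv_on_def)
  have "continuous_on {0..b} (nth_deriv_on {0..b} 4 f)"
    using C4 by (simp add: C_k_on_def)
  from compact_imp_bounded[OF compact_continuous_image[OF this compact_Icc]]
  obtain K where "K > 0" and K: "\<forall>x\<in>{0..b}. \<bar>nth_deriv_on {0..b} 4 f x\<bar> \<le> K"
    by (auto simp: bounded_pos)
  \<comment> \<open>The choice \<open>m = 0\<close>, \<open>d = 0\<close> sends the whole quartic
    term into the remainder, which suffices at order 4.\<close>
  then have "\<forall>x\<in>{0..b}. \<bar>nth_deriv_on {0..b} 4 f x - 0\<bar> \<le> K * x ^ 0"
    by simp
  note taylor = taylor_expansions[OF C4 less_imp_le[OF \<open>0 < b\<close>] order_refl this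
      less_imp_le[OF \<open>K > 0\<close>], folded p_def c_def, unfolded curvature add_0 add_0_right div_0 mult_zero_left]
  then obtain u v w where expansions: "\<forall>x\<in>{0..b}.
      f x = f 0 + p * x + c / 6 * x ^ 3 + u x * x ^ 4 \<and>
      nth_deriv_on {0..b} 1 f x = p + c / 2 * x ^ 2 + v x * x ^ 3 \<and>
      integral {0..x} f = f 0 * x + p / 2 * x ^ 2 + c / 24 * x ^ 4 + w x * x ^ 5 \<and>
      \<bar>u x\<bar> \<le> K \<and> \<bar>v x\<bar> \<le> K \<and> \<bar>w x\<bar> \<le> K"
    by (elim exE) (rule that)
  note f_eq = expansions[THEN bspec, THEN conjunct1]
    and f'_eq = expansions[THEN bspec, THEN conjunct2, THEN conjunct1]
    and int_eq = expansions[THEN bspec, THEN conjunct2, THEN conjunct2, THEN conjunct1]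
    and bounds = expansions[THEN bspec, THEN conjunct2, THEN conjunct2, THEN conjunct2, THEN conjunct1]
      expansions[THEN bspec, THEN conjunct2, THEN conjunct2, THEN conjunct2, THEN conjunct2, THEN conjunct1]
      expansions[THEN bspec, THEN conjunct2, THEN conjunct2, THEN conjunct2, THEN conjunct2, THEN conjunct2]
  let ?B = "\<lambda>h. bezier {0..b} f h (r1_of P h) (r2_of {0..b} f P h)"
  let ?I = "{h. area_preserving_interpolant {0..b} f h (r1_of P h) (r2_of {0..b} f P h)}"
  \<comment> \<open>Restricting the filter to admissible \<open>h\<close> makes the hypothesis
    available in every asymptotic step; unfolding \<open>G\<close> at the end gives back the
    implication.\<close>
  define G where "G = inf (at_right (0::real)) (principal ?I)"
  have G: "G \<le> at_right 0"
    by (simp add: G_def)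
  have I: "\<forall>\<^sub>F h in G. h \<in> ?I"
    unfolding G_def eventually_inf_principal by simp
  have small: "\<forall>\<^sub>F h in G. h < x" if "x > 0" for x
    using that by (intro filter_leD[OF G]) (auto simp: eventually_at_right_field)
  have pos: "\<forall>\<^sub>F h in G. h > 0"
    by (intro filter_leD[OF G]) (auto simp: eventually_at_right_less)
  have le_1: "\<forall>\<^sub>F h in G. \<bar>h\<bar> \<le> 1"
    using small[OF zero_less_one] pos by eventually_elim auto
  then have h: "(\<lambda>h. h) \<in> O[G](\<lambda>_. 1)"
    by (rule bounded_bigo_1)
  have in_b: "\<forall>\<^sub>F h in G. h \<in> {0..b}"
    using small[OF \<open>0 < b\<close>] pos by eventually_elim auto
  have u: "u \<in> O[G](\<lambda>_. 1)" and v: "v \<in> O[G](\<lambda>_. 1)" and w: "w \<in> O[G](\<lambda>_. 1)"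
    by (rule bounded_bigo_1, rule eventually_mono[OF in_b], rule bounds, assumption)+

  define q where "q h = r2_of {0..b} f P h / h" for h
  have "\<forall>\<^sub>F h in G. \<bar>q h\<bar> \<le> 5 + \<bar>P\<bar>"
    using I pos le_1
  proof eventually_elim
    case (elim h)
    let ?r1 = "r1_of P h" and ?r2 = "r2_of {0..b} f P h"
    \<comment> \<open>the admissibility of the abscissa at \<open>t = 1/2\<close> is what bounds \<open>r2\<close>\<close>
    have "fst (?B h (1/2)) \<ge> 0" "?r2 > 0"
      using elim by (auto simp: area_preserving_interpolant_def)
    then have "?r2 \<le> ?r1 + 4 * h"
      by (simp add: fst_bezier field_simps eval_nat_numeral)
    also have "?r1 \<le> h + \<bar>P\<bar> * h ^ 1"
      unfolding r1_of_def using elim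
      by (intro add_left_mono mult_mono power_decreasing) auto
    finally show ?case
      using elim \<open>?r2 > 0\<close> by (simp add: q_def field_simps)
  qed
  then have q: "q \<in> O[G](\<lambda>_. 1)"
    by (rule bounded_bigo_1)

  \<comment> \<open>The factor \<open>c\<close> keeps \<open>k\<close> bounded when \<open>c = 0\<close>, where \<open>r2 / h\<close> need not tend to 1.\<close>
  define k where "k h = c * (q h - 1) / h" for h
  have k: "k \<in> O[G](\<lambda>_. 1)"
  proof (cases "c = 0")
    case True
    then show ?thesis by (simp add: k_def[abs_def])
  next
    case False
    \<comment> \<open>Numerator and denominator are \<open>h ^ 4 * (M h + h * Z h)\<close> and
      \<open>h ^ 3 * M h\<close>, so \<open>r2 / h - 1\<close> equals \<open>h * Z h / M h\<close>;
      \<open>M\<close> tends to a nonzero multiple of \<open>c\<close>.\<close>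
    define B where "B h = 6 * u h - 5 * v h + P * (c / 2 + v h * h) * h" for h
    define M where "M h = - 3 / 2 * c + h * B h" for h
    define Z where "Z h = 60 * w h - 30 * u h + 5 * v h + P * (c / 2 + (6 * u h - v h) * h) * h" for h
    have "B \<in> O[G](\<lambda>_. 1)"
      unfolding B_def by (intro bigo_1_intros h u v)
    then have "(M \<longlongrightarrow> - 3 / 2 * c) G"
      unfolding M_def by (rule tendsto_perturbation[OF G])
    from tendsto_nonzero_bigo_1_inverse[OF this] False
    have M: "(\<lambda>h. inverse (M h)) \<in> O[G](\<lambda>_. 1)" "\<forall>\<^sub>F h in G. M h \<noteq> 0"
      by auto
    have bound: "(\<lambda>h. c * Z h * inverse (M h)) \<in> O[G](\<lambda>_. 1)"
      unfolding Z_def by (intro bigo_1_intros h u v w M(1))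
    have "\<forall>\<^sub>F h in G. k h = c * Z h * inverse (M h)"
      using pos in_b M(2)
    proof eventually_elim
      fix h assume "h > 0" and h: "h \<in> {0..b}" and "M h \<noteq> 0"
      have den: "r1_of P h * cross2 (tangent {0..b} f 0) (tangent {0..b} f h)
          + 6 * cross2 (tangent {0..b} f h) (chord f h) = h ^ 3 * M h"
        unfolding r2_of_denominator f_eq[OF h] f'_eq[OF h] r1_of_def M_def B_def p_def[symmetric]
        by (simp add: field_simps) algebra
      have "6 * (10 * secant_area f h - r1_of P h * cross2 (chord f h) (tangent {0..b} f 0))
          = h ^ 4 * (M h + h * Z h)"
        unfolding r2_of_numerator f_eq[OF h] int_eq[OF h] r1_of_def Z_def M_def B_def p_def[symmetric]
        by (simp add: field_simps) algebra
      then have "r2_of {0..b} f P h = h ^ 4 * (M h + h * Z h) / (h ^ 3 * M h)"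
        unfolding r2_of_def den by simp
      also have "\<dots> = h * (1 + h * (Z h * inverse (M h)))"
        using \<open>M h \<noteq> 0\<close> \<open>h > 0\<close> by (simp add: field_simps eval_nat_numeral)
      finally show "k h = c * Z h * inverse (M h)"
        unfolding k_def q_def using \<open>h > 0\<close> by simp
    qed
    from landau_o.big.in_cong[OF this] bound show ?thesis
      by (rule iffD2)
  qed

  let ?F = "G \<times>\<^sub>F principal {0..1::real}"
  define X where "X \<omega> = snd \<omega> + (fst \<omega>)\<^sup>2 * P * (1 - snd \<omega>)\<^sup>2 * snd \<omega>
    - (q (fst \<omega>) - 1) * ((snd \<omega>)\<^sup>2 - snd \<omega> ^ 3)" for \<omega>
  define \<sigma> where "\<sigma> \<omega> = c * fst \<omega> * P * (1 - snd \<omega>)\<^sup>2 * snd \<omega>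
    - k (fst \<omega>) * ((snd \<omega>)\<^sup>2 - snd \<omega> ^ 3)" for \<omega>
  define Q where "Q \<omega> = (let h = fst \<omega>; t = snd \<omega> in
      u h * (3 * t\<^sup>2 - 2 * t ^ 3) - q h * v h * (t\<^sup>2 - t ^ 3) - u (h * X \<omega>) * X \<omega> ^ 4
      - k h / 2 * (t\<^sup>2 - t ^ 3) - \<sigma> \<omega> / 6 * ((X \<omega>)\<^sup>2 + X \<omega> * t + t\<^sup>2))" for \<omega>
  have X_eq: "fst (?B h t) = h * X (h, t)" if "h > 0" for h t
    using that unfolding X_def q_def r1_of_def fst_bezier fst_conv snd_conv
    by (simp add: field_simps) algebra
  \<comment> \<open>As \<open>X\<close> need not be close to \<open>t\<close>, this is taken from
    admissibility instead of an estimate.\<close>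
  have X_in: "\<forall>\<^sub>F \<omega> in ?F. fst \<omega> * X \<omega> \<in> {0..b}"
    using eventually_fst[OF pos] eventually_fst[OF I] eventually_snd_principal
  proof eventually_elim
    case (elim \<omega>)
    then have "fst (?B (fst \<omega>) (snd \<omega>)) \<in> {0..b}"
      unfolding area_preserving_interpolant_def by blast
    then show ?case
      using X_eq[of "fst \<omega>" "snd \<omega>"] elim by simp
  qed
  note t = bigo_1_snd_unit_interval[of G]
  note h' = bigo_1_fst[OF h] and u' = bigo_1_fst[OF u] and v' = bigo_1_fst[OF v]
    and q' = bigo_1_fst[OF q] and k' = bigo_1_fst[OF k]
  have X: "X \<in> O[?F](\<lambda>_. 1)" and \<sigma>: "\<sigma> \<in> O[?F](\<lambda>_. 1)"
    unfolding X_def \<sigma>_def by (intro bigo_1_intros t h' q' k')+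
  have \<rho>: "(\<lambda>\<omega>. u (fst \<omega> * X \<omega>)) \<in> O[?F](\<lambda>_. 1)"
    by (rule bounded_bigo_1, rule eventually_mono[OF X_in], rule bounds, assumption)
  have Q: "Q \<in> O[?F](\<lambda>_. 1)"
    unfolding Q_def Let_def by (intro bigo_1_intros t X \<sigma> u' v' q' k' \<rho>)
  have error: "\<forall>\<^sub>F \<omega> in ?F. snd (?B (fst \<omega>) (snd \<omega>)) - f (fst (?B (fst \<omega>) (snd \<omega>))) = fst \<omega> ^ 4 * Q \<omega>"
    using X_in eventually_fst[OF in_b] eventually_fst[OF pos]
  proof eventually_elim
    case (elim \<omega>)
    obtain h t where \<omega>: "\<omega> = (h, t)" by fastforce
    have h: "h \<in> {0..b}" and "h > 0" and x: "h * X (h, t) \<in> {0..b}"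
      using elim unfolding \<omega> by simp_all
    have r2: "r2_of {0..b} f P h = h * q h" and k: "c * q h = c + h * k h"
      using \<open>h > 0\<close> by (simp_all add: q_def k_def field_simps)
    have \<sigma>: "\<sigma> (h, t) = c * h * P * (1 - t)\<^sup>2 * t - k h * (t\<^sup>2 - t ^ 3)"
      and X: "X (h, t) = t + h\<^sup>2 * P * (1 - t)\<^sup>2 * t - (q h - 1) * (t\<^sup>2 - t ^ 3)"
      by (simp_all add: \<sigma>_def X_def)
    show ?case
      unfolding \<omega> fst_conv snd_conv Q_def Let_def
      by (rule bezier_error_zero_curvature(2)[OF r1_of_def r2 k \<sigma> X
        f_eq[OF h, unfolded p_def] f'_eq[OF h, unfolded p_def] f_eq[OF x, unfolded p_def]])
  qed
  obtain C where C: "\<forall>\<^sub>F h in G. \<forall>t\<in>{0..1}. \<bar>snd (?B h t) - f (fst (?B h t))\<bar> \<le> C * \<bar>h ^ 4\<bar>"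
    by (rule bigo_1_uniformly[OF Q, where r = "\<lambda>h. h ^ 4"
          and E = "\<lambda>h t. snd (?B h t) - f (fst (?B h t))"])
       (rule error, rule that)
  with I have final: "\<forall>\<^sub>F h in G. interp_error f (?B h) \<le> ereal (C * h ^ 4)"
  proof eventually_elim
    case (elim h)
    then have range: "\<forall>t\<in>{0..1}. fst (?B h t) \<in> {0..b}"
      unfolding area_preserving_interpolant_def mem_Collect_eq by (elim conjE)
    have abs_h: "\<bar>h ^ 4\<bar> = h ^ 4" by simp
    show ?case
      by (rule interp_error_bezier_le[OF cont])
         (erule bspec[OF range], erule bspec[OF elim(2)[unfolded abs_h]])
  qed
  show ?thesis
    by (rule exI[of _ C], rule final[unfolded G_def eventually_inf_principal mem_Collect_eq])
qed

section \<open>Curvature at the right endpoint and combination of the cases\<close>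

lemma eventually_graph_curvature_nonzero:
  assumes "0 < b" "C_k_on k {0..b} f" "2 < k" "graph_curvature {0..b} f 0 \<noteq> 0"
  shows "\<forall>\<^sub>F h in at_right 0. graph_curvature {0..b} f h \<noteq> 0"
proof -
  have "(nth_deriv_on {0..b} 2 f \<longlongrightarrow> nth_deriv_on {0..b} 2 f 0) (at 0 within {0..b})"
    by (rule continuous_on_if_C_k_on[OF assms(2,3), unfolded continuous_on_def, THEN bspec])
       (use \<open>0 < b\<close> in simp)
  then have "(nth_deriv_on {0..b} 2 f \<longlongrightarrow> nth_deriv_on {0..b} 2 f 0) (at_right 0)"
    using at_within_Icc_at_right[OF \<open>0 < b\<close>] by simp
  then show ?thesis
    using assms(4) unfolding graph_curvature_eq_0_iff by (rule tendsto_imp_eventually_ne)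
qed

text \<open>By continuity, nonzero curvature at 0 forces nonzero curvature at all small
  \<open>h\<close>, so the curvature at 0 alone decides which case occurs; the other case is
  eventually vacuous.\<close>

theorem theorem2p7:
  fixes f :: "real \<Rightarrow> real" and P b :: real
  assumes "0 < b" and "C_k_on 4 {0..b} f"
  shows
    "((\<lambda>x. nth_deriv_on {0..b} 4 f x - nth_deriv_on {0..b} 4 f 0) \<in> O[at_right 0](\<lambda>x. x) \<longrightarrow>
       (\<exists>C::real. \<forall>\<^sub>F h in at_right 0.
          graph_curvature {0..b} f 0 \<noteq> 0 \<and> graph_curvature {0..b} f h \<noteq> 0 \<longrightarrow>
          area_preserving_interpolant {0..b} f h (r1_of P h) (r2_of {0..b} f P h) \<and>
          interp_error f (bezier {0..b} f h (r1_of P h) (r2_of {0..b} f P h)) \<le> ereal (C * h ^ 5)))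
     \<and>
     (\<exists>C::real. \<forall>\<^sub>F h in at_right 0.
          (graph_curvature {0..b} f 0 = 0 \<or> graph_curvature {0..b} f h = 0) \<longrightarrow>
          area_preserving_interpolant {0..b} f h (r1_of P h) (r2_of {0..b} f P h) \<longrightarrow>
          interp_error f (bezier {0..b} f h (r1_of P h) (r2_of {0..b} f P h)) \<le> ereal (C * h ^ 4))"
proof (cases "graph_curvature {0..b} f 0 = 0")
  case True
  then have "nth_deriv_on {0..b} 2 f 0 = 0"
    unfolding graph_curvature_eq_0_iff .
  from interpolation_zero_curvature[OF assms this, of P] obtain C where C: "\<forall>\<^sub>F h in at_right 0.
      area_preserving_interpolant {0..b} f h (r1_of P h) (r2_of {0..b} f P h) \<longrightarrow>
      interp_error f (bezier {0..b} f h (r1_of P h) (r2_of {0..b} f P h)) \<le> ereal (C * h ^ 4)"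
    by (rule exE)
  \<comment> \<open>The first conjunct has a false premise here, so any constant works; 0 is
    taken.\<close>
  show ?thesis
    by (intro conjI impI, rule exI[of _ 0], rule always_eventually, use True in blast,
        rule exI[of _ C], rule eventually_mono[OF C], blast)
next
  case False
  then have a: "nth_deriv_on {0..b} 2 f 0 \<noteq> 0"
    unfolding graph_curvature_eq_0_iff .
  have curv: "\<forall>\<^sub>F h in at_right 0. graph_curvature {0..b} f h \<noteq> 0"
    using eventually_graph_curvature_nonzero[OF assms _ False] by simp
  show ?thesis
  proof (intro conjI impI)
    assume "(\<lambda>x. nth_deriv_on {0..b} 4 f x - nth_deriv_on {0..b} 4 f 0) \<in> O[at_right 0](\<lambda>x. x)"
    from interpolation_nonzero_curvature[OF assms this a, of P] obtain C where C: "\<forall>\<^sub>F h in at_right 0.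
        area_preserving_interpolant {0..b} f h (r1_of P h) (r2_of {0..b} f P h) \<and>
        interp_error f (bezier {0..b} f h (r1_of P h) (r2_of {0..b} f P h)) \<le> ereal (C * h ^ 5)"
      by (rule exE)
    show "\<exists>C. \<forall>\<^sub>F h in at_right 0.
        graph_curvature {0..b} f 0 \<noteq> 0 \<and> graph_curvature {0..b} f h \<noteq> 0 \<longrightarrow>
        area_preserving_interpolant {0..b} f h (r1_of P h) (r2_of {0..b} f P h) \<and>
        interp_error f (bezier {0..b} f h (r1_of P h) (r2_of {0..b} f P h)) \<le> ereal (C * h ^ 5)"
      by (rule exI[of _ C], rule eventually_mono[OF C], rule impI)
  next
    show "\<exists>C. \<forall>\<^sub>F h in at_right 0.
        (graph_curvature {0..b} f 0 = 0 \<or> graph_curvature {0..b} f h = 0) \<longrightarrow>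
        area_preserving_interpolant {0..b} f h (r1_of P h) (r2_of {0..b} f P h) \<longrightarrow>
        interp_error f (bezier {0..b} f h (r1_of P h) (r2_of {0..b} f P h)) \<le> ereal (C * h ^ 4)"
      \<comment> \<open>Both disjuncts of the premise fail for small \<open>h\<close>, so the
        constant is arbitrary.\<close>
      by (rule exI[of _ 0], rule eventually_mono[OF curv]) (use False in blast)
  qed
qed

end
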